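(* Let $d$ be a positive integer, let $\alpha > 0$, and let $\Sigma = (\sigma_{ij})$ be a real symmetric positive semidefinite $d\times d$ matrix. Let $(X_1,\ldots,X_d)$ be a random vector with the $\mathrm{Gamma}_d(\alpha,\Sigma)$ distribution. Suppose there exists a sign matrix $S = \mathrm{diag}(s_1,\ldots,s_d)$ such that all the elements of $S\Sigma S$ are nonnegative, i.e., $\sigma_{ij}s_is_j \ge 0$ for all $1\le i<j\le d$. Then for every subset $I\subset\{1,\ldots,d\}$, with $I^c = \{1,\ldots,d\}\setminus I$, and for all nonnegative integers $n_1,\ldots,n_d$, $$ \mathbb{E}\Big(\prod_{j=1}^d X_j^{n_j}\Big) \ \ge\ \mathbb{E}\Big(\prod_{j\in I} X_j^{n_j}\Big)\cdot \mathbb{E}\Big(\prod_{j\in I^c} X_j^{n_j}\Big). $$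
   Context: A sign matrix is a diagonal matrix $S = \mathrm{diag}(s_1,\ldots,s_d)$ with $s_j\in\{-1,1\}$ for all $j$. Multivariate gamma distribution (in the sense of Krishnamoorthy and Parthasarathy): for $\alpha>0$ and a positive semidefinite $d\times d$ matrix $\Sigma$, a random vector $(X_1,\ldots,X_d)$ is said to have the $\mathrm{Gamma}_d(\alpha,\Sigma)$ distribution if, for all sufficiently small $t_1,\ldots,t_d\in\mathbb{R}$, with $T = \mathrm{diag}(t_1,\ldots,t_d)$ and $I_d$ the $d\times d$ identity matrix, its moment-generating function is $$\mathbb{E}\exp\Big(\sum_{j=1}^d t_jX_j\Big) = \det(I_d-\Sigma T)^{-\alpha}.$$ Such a distribution need not exist for every pair $(\alpha,\Sigma)$; the hypothesis of the result is that $(X_1,\ldots,X_d)$ has this distribution. Here $2\alpha$ (the "degree-of-freedom parameter") need not be an integer. Empty products equal $1$. *)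

theory Defs
  imports "HOL-Probability.Probability"
begin

definition diag_matrix :: "real ^ 'd \<Rightarrow> real ^ 'd ^ 'd" where
  "diag_matrix v = (\<chi> i j. if i = j then v $ i else 0)"

definition sign_matrix :: "real ^ 'd ^ 'd \<Rightarrow> bool" where
  "sign_matrix S \<longleftrightarrow> (\<exists>s. (\<forall>j. s $ j \<in> {-1, 1}) \<and> S = diag_matrix s)"

definition pos_semidef :: "real ^ 'd ^ 'd \<Rightarrow> bool" where
  "pos_semidef A \<longleftrightarrow> transpose A = A \<and> (\<forall>x. x \<bullet> (A *v x) \<ge> 0)"

(* The moment-generating function is required to be finite near 0, which is why
   integrability is part of the condition.  For t near 0 the determinant is positive
   (it is continuous in t and equals 1 at t = 0), so powr is the usual real power there. *)
definition gamma_distributed ::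
    "'a measure \<Rightarrow> real \<Rightarrow> real ^ 'd ^ 'd \<Rightarrow> ('a \<Rightarrow> real ^ 'd) \<Rightarrow> bool" where
  "gamma_distributed M \<alpha> \<Sigma> X \<longleftrightarrow>
     X \<in> borel_measurable M \<and>
     (\<forall>\<^sub>F t in nhds 0.
        has_bochner_integral M (\<lambda>\<omega>. exp (\<Sum>j\<in>UNIV. t $ j * X \<omega> $ j))
          (det (mat 1 - \<Sigma> ** diag_matrix t) powr (- \<alpha>)))"

end

theory Submission
  imports Defs
begin

text \<open>
  Conjugating \<open>\<Sigma>\<close> by the sign matrix does not change \<open>det (I - \<Sigma>T)\<close>, so all entries of \<open>\<Sigma>\<close> may be
  taken nonnegative. Put \<open>G = (I - \<Sigma>T)\<inverse>\<Sigma>\<close> and let \<open>\<phi>\<close> be the moment generating function. Then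
  \<open>\<partial>\<^sub>k \<phi> = \<alpha> G\<^sub>k\<^sub>k \<phi>\<close> and \<open>\<partial>\<^sub>k G\<^sub>i\<^sub>j = G\<^sub>i\<^sub>k G\<^sub>k\<^sub>j\<close>, so the cone of polynomials in the entries of \<open>G\<close>
  with nonnegative coefficients is closed under partial derivatives. For a list \<open>l\<close> of indices let
  \<open>m\<^sub>l = \<partial>\<^sub>l \<phi> / \<phi>\<close>, whose value at \<open>0\<close> is a moment. The recursion
  \<open>m\<^sub>k\<^sub>l = \<partial>\<^sub>k m\<^sub>l + \<alpha> G\<^sub>k\<^sub>k m\<^sub>l\<close> and the Leibniz rule show by induction on \<open>l\<close> that
  \<open>m\<^bsub>l l'\<^esub> - m\<^sub>l m\<^bsub>l'\<^esub>\<close> lies in this cone; evaluate it at \<open>t = 0\<close>, where \<open>G = \<Sigma>\<close>.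
\<close>

section \<open>Differentiation under the integral sign\<close>

lemma abs_exp_minus_one_le: "\<bar>exp u - 1\<bar> \<le> \<bar>u\<bar> * exp \<bar>u\<bar>" for u :: real
proof (cases "u \<ge> 0")
  case True
  have "(1 - u) * exp u \<le> exp (- u) * exp u"
    using exp_ge_add_one_self[of "- u"] by (intro mult_right_mono) auto
  then show ?thesis using True by (simp add: exp_minus algebra_simps)
next
  case False
  have "exp u \<le> 1" "\<bar>u\<bar> = - u" using False by auto
  then have "\<bar>exp u - 1\<bar> \<le> \<bar>u\<bar> * 1" using exp_ge_add_one_self[of u] by linarith
  also have "\<dots> \<le> \<bar>u\<bar> * exp \<bar>u\<bar>" by (intro mult_left_mono) auto
  finally show ?thesis .
qed

text \<open>Supplies the dominating function for difference quotients of exponential integrals. The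
  factor \<bar>y\<bar> left by \<open>abs_exp_minus_one_le\<close> is absorbed into a second copy of
  \<open>exp (c * \<bar>y\<bar>)\<close>, which costs the division by \<open>c\<close> and doubles
  the exponent.\<close>

lemma abs_exp_diff_quotient_le:
  fixes s y c :: real
  assumes "c > 0" "\<bar>s\<bar> \<le> c" "s \<noteq> 0"
  shows "\<bar>(exp (s * y) - 1) / s\<bar> \<le> (exp (2 * c * y) + exp (- (2 * c) * y)) / c"
proof -
  have "\<bar>exp (s * y) - 1\<bar> \<le> \<bar>s\<bar> * (\<bar>y\<bar> * exp (\<bar>s\<bar> * \<bar>y\<bar>))"
    using abs_exp_minus_one_le[of "s * y"] by (simp add: abs_mult mult.assoc)
  then have "\<bar>(exp (s * y) - 1) / s\<bar> \<le> \<bar>y\<bar> * exp (\<bar>s\<bar> * \<bar>y\<bar>)"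
    using assms(3) by (simp add: abs_divide field_simps)
  also have "\<dots> \<le> \<bar>y\<bar> * exp (c * \<bar>y\<bar>)"
    using assms by (intro mult_left_mono) (auto intro: mult_right_mono)
  also have "\<bar>y\<bar> * exp (c * \<bar>y\<bar>) \<le> exp (c * \<bar>y\<bar>) / c * exp (c * \<bar>y\<bar>)"
  proof (rule mult_right_mono)
    have "c * \<bar>y\<bar> \<le> exp (c * \<bar>y\<bar>)" using exp_ge_add_one_self[of "c * \<bar>y\<bar>"] by linarith
    then show "\<bar>y\<bar> \<le> exp (c * \<bar>y\<bar>) / c" using assms(1) by (simp add: pos_le_divide_eq mult.commute)
  qed simp
  also have "\<dots> = exp (2 * c * \<bar>y\<bar>) / c" by (simp add: exp_add[symmetric])
  also have "\<dots> \<le> (exp (2 * c * y) + exp (- (2 * c) * y)) / c"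
    using assms(1) by (intro divide_right_mono) (auto simp: abs_if)
  finally show ?thesis .
qed

text \<open>Dominated convergence applied to the difference quotients at 0. The weight
  \<open>W\<close> holds the factors produced by earlier differentiations, and the integrability
  claim lets the lemma be iterated.\<close>

lemma has_real_derivative_integral_exp:
  fixes W Y :: "'a \<Rightarrow> real"
  assumes Y [measurable]: "Y \<in> borel_measurable M" and "c > 0"
    and int: "\<And>s. \<bar>s\<bar> \<le> c \<Longrightarrow> integrable M (\<lambda>\<omega>. W \<omega> * exp (s * Y \<omega>))"
  shows "integrable M (\<lambda>\<omega>. Y \<omega> * W \<omega>)"
    and "((\<lambda>s. \<integral>\<omega>. W \<omega> * exp (s * Y \<omega>) \<partial>M) has_real_derivative (\<integral>\<omega>. Y \<omega> * W \<omega> \<partial>M)) (at 0)"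
proof -
  \<comment> \<open>The bound of \<open>abs_exp_diff_quotient_le\<close> with \<open>c / 2\<close>
    in place of \<open>c\<close>: its exponentials then sit at \<open>c\<close> and
    \<open>- c\<close>, where \<open>int\<close> still applies.\<close>
  define w where "w = (\<lambda>\<omega>. \<bar>W \<omega>\<bar> * ((exp (c * Y \<omega>) + exp (- c * Y \<omega>)) / (c / 2)))"
  have W: "integrable M W" using int[of 0] \<open>c > 0\<close> by simp
  then have [measurable]: "W \<in> borel_measurable M" by simp
  have "integrable M (\<lambda>\<omega>. (\<bar>W \<omega> * exp (c * Y \<omega>)\<bar> + \<bar>W \<omega> * exp (- c * Y \<omega>)\<bar>) / (c / 2))"
    using int[of c] int[of "- c"] \<open>c > 0\<close> by (intro integrable_divide Bochner_Integration.integrable_add integrable_abs) auto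
  then have w: "integrable M w"
    by (simp add: w_def abs_mult algebra_simps)
  define q where "q = (\<lambda>s \<omega>. W \<omega> * ((exp (s * Y \<omega>) - 1) / s))"
  have q_le: "norm (q s \<omega>) \<le> w \<omega>" if "\<bar>s\<bar> \<le> c / 2" "s \<noteq> 0" for s \<omega>
    using abs_exp_diff_quotient_le[of "c / 2" s "Y \<omega>"] that \<open>c > 0\<close>
    unfolding q_def w_def real_norm_def abs_mult by (intro mult_left_mono) auto
  have q_lim: "((\<lambda>s. q s \<omega>) \<longlongrightarrow> Y \<omega> * W \<omega>) (at 0)" for \<omega>
  proof -
    have "((\<lambda>s. exp (s * Y \<omega>)) has_real_derivative Y \<omega>) (at 0)"
      by (auto intro!: derivative_eq_intros)
    then have "((\<lambda>s. (exp (s * Y \<omega>) - 1) / s) \<longlongrightarrow> Y \<omega>) (at 0)"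
      by (simp add: DERIV_def)
    then show ?thesis unfolding q_def using tendsto_mult_left[of _ "Y \<omega>" "at 0" "W \<omega>"] by (metis mult.commute)
  qed
  have conv: "(\<lambda>i. integral\<^sup>L M (q (S i))) \<longlonglongrightarrow> (\<integral>\<omega>. Y \<omega> * W \<omega> \<partial>M)"
    "integrable M (\<lambda>\<omega>. Y \<omega> * W \<omega>)"
    if S: "\<And>i. S i \<in> ball 0 (c / 2) - {0}" "S \<longlonglongrightarrow> 0" for S
  proof -
    have lim: "AE \<omega> in M. (\<lambda>i. q (S i) \<omega>) \<longlonglongrightarrow> Y \<omega> * W \<omega>"
    proof (rule AE_I2)
      fix \<omega>
      have "\<forall>i. S i \<in> UNIV - {0}" using S(1) by auto
      then show "(\<lambda>i. q (S i) \<omega>) \<longlonglongrightarrow> Y \<omega> * W \<omega>"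
        using q_lim[of \<omega>] S(2) unfolding tendsto_at_iff_sequentially o_def by blast
    qed
    have bound: "AE \<omega> in M. norm (q (S i) \<omega>) \<le> w \<omega>" for i
      using S(1)[of i] by (intro AE_I2 q_le) auto
    have meas: "q (S i) \<in> borel_measurable M" for i unfolding q_def by measurable
    show "(\<lambda>i. integral\<^sup>L M (q (S i))) \<longlonglongrightarrow> (\<integral>\<omega>. Y \<omega> * W \<omega> \<partial>M)"
      by (rule integral_dominated_convergence[OF _ meas w lim bound]) measurable
    show "integrable M (\<lambda>\<omega>. Y \<omega> * W \<omega>)"
      by (rule integrable_dominated_convergence[OF _ meas w lim bound]) measurable
  qed
  show "integrable M (\<lambda>\<omega>. Y \<omega> * W \<omega>)"
  proof (rule conv(2))
    \<comment> \<open>Any null sequence in the punctured ball would do; the factor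
      \<open>c / 4\<close> keeps every term inside it.\<close>
    show "(\<lambda>i. c / 4 * (1 / real (Suc i))) \<longlonglongrightarrow> 0"
      by (rule tendsto_mult_right_zero[OF LIMSEQ_Suc[OF lim_1_over_n]])
    fix i
    define x where "x = c / 4 * (1 / real (Suc i))"
    have "x \<le> c / 4 * 1" unfolding x_def
      using \<open>c > 0\<close> by (intro mult_left_mono) auto
    moreover have "x > 0" unfolding x_def using \<open>c > 0\<close> by simp
    ultimately have "x \<in> ball 0 (c / 2) - {0}"
      using \<open>c > 0\<close> by simp
    then show "c / 4 * (1 / real (Suc i)) \<in> ball 0 (c / 2) - {0}" by (simp only: x_def)
  qed
  \<comment> \<open>The limit is first taken within the ball, so that every test sequence stays
    where the bound \<open>w\<close> holds. The ball is open, so this is the full limit at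
    0.\<close>
  have "((\<lambda>s. integral\<^sup>L M (q s)) \<longlongrightarrow> (\<integral>\<omega>. Y \<omega> * W \<omega> \<partial>M)) (at 0 within ball 0 (c / 2))"
    unfolding tendsto_at_iff_sequentially o_def using conv(1) by blast
  moreover have "integral\<^sup>L M (q s) = ((\<integral>\<omega>. W \<omega> * exp (s * Y \<omega>) \<partial>M) - (\<integral>\<omega>. W \<omega> * exp (0 * Y \<omega>) \<partial>M)) / (s - 0)"
    if "s \<in> ball 0 (c / 2)" for s
  proof -
    have "q s = (\<lambda>\<omega>. (W \<omega> * exp (s * Y \<omega>) - W \<omega>) / s)"
      by (simp add: q_def fun_eq_iff right_diff_distrib)
    then show ?thesis using int[of s] W that \<open>c > 0\<close> by simp
  qed
  then have "\<forall>\<^sub>F s in at 0 within ball 0 (c / 2). integral\<^sup>L M (q s) =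
      ((\<integral>\<omega>. W \<omega> * exp (s * Y \<omega>) \<partial>M) - (\<integral>\<omega>. W \<omega> * exp (0 * Y \<omega>) \<partial>M)) / (s - 0)"
    by (simp add: eventually_at_filter)
  ultimately have *: "((\<lambda>s. \<integral>\<omega>. W \<omega> * exp (s * Y \<omega>) \<partial>M) has_real_derivative (\<integral>\<omega>. Y \<omega> * W \<omega> \<partial>M)) (at 0 within ball 0 (c / 2))"
    unfolding has_field_derivative_iff by (rule Lim_transform_eventually)
  show "((\<lambda>s. \<integral>\<omega>. W \<omega> * exp (s * Y \<omega>) \<partial>M) has_real_derivative (\<integral>\<omega>. Y \<omega> * W \<omega> \<partial>M)) (at 0)"
  proof -
    have "at (0 :: real) within ball 0 (c / 2) = at 0"
      by (rule at_within_open) (use \<open>c > 0\<close> in auto)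
    with * show ?thesis by (simp only:)
  qed
qed

section \<open>Partial derivatives as one-variable derivatives along coordinate lines\<close>

definition has_partial :: "(real ^ 'd \<Rightarrow> real) \<Rightarrow> real \<Rightarrow> real ^ 'd \<Rightarrow> 'd \<Rightarrow> bool" where
  "has_partial f D t k \<longleftrightarrow> ((\<lambda>s. f (t + s *\<^sub>R axis k 1)) has_real_derivative D) (at 0)"

text \<open>Since \<open>U\<close> is open, a short piece of the coordinate line through
  \<open>t\<close> stays in \<open>U\<close>. Identities known only on \<open>U\<close> can
  therefore be differentiated there.\<close>

lemma has_partial_cong:
  assumes "open U" "t \<in> U" "\<And>u. u \<in> U \<Longrightarrow> f u = g u"
  shows "has_partial f D t k \<longleftrightarrow> has_partial g D t k"
proof -
  have "((\<lambda>s. t + s *\<^sub>R axis k 1) \<longlongrightarrow> t) (nhds (0::real))"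
    by (auto intro!: tendsto_eq_intros filterlim_ident)
  then have "\<forall>\<^sub>F s in nhds (0::real). t + s *\<^sub>R axis k 1 \<in> U"
    using assms(1,2) by (simp add: topological_tendstoD)
  then have "\<forall>\<^sub>F s in nhds (0::real). f (t + s *\<^sub>R axis k 1) = g (t + s *\<^sub>R axis k 1)"
    by eventually_elim (rule assms(3))
  then show ?thesis unfolding has_partial_def by (intro DERIV_cong_ev) auto
qed

lemma has_partial_unique: "has_partial f D t k \<Longrightarrow> has_partial f E t k \<Longrightarrow> D = E"
  unfolding has_partial_def by (rule DERIV_unique)

lemma has_partial_const: "has_partial (\<lambda>_. c) 0 t k"
  unfolding has_partial_def by simp

lemma has_partial_add:
  "has_partial f D t k \<Longrightarrow> has_partial g E t k \<Longrightarrow> has_partial (\<lambda>u. f u + g u) (D + E) t k"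
  unfolding has_partial_def by (rule DERIV_add)

lemma has_partial_mult:
  "has_partial f D t k \<Longrightarrow> has_partial g E t k \<Longrightarrow>
    has_partial (\<lambda>u. f u * g u) (D * g t + f t * E) t k"
  unfolding has_partial_def by (auto intro!: derivative_eq_intros)

lemma has_partial_divide:
  "has_partial f D t k \<Longrightarrow> has_partial g E t k \<Longrightarrow> g t \<noteq> 0 \<Longrightarrow>
    has_partial (\<lambda>u. f u / g u) ((D * g t - f t * E) / (g t * g t)) t k"
  unfolding has_partial_def by (auto intro!: derivative_eq_intros)

section \<open>The cone of nonnegative polynomials and the abstract moment inequality\<close>

text \<open>Polynomials with nonnegative coefficients in the entries of \<open>G\<close>, up to equality on \<open>U\<close>.\<close>

inductive_set posy :: "'t set \<Rightarrow> ('t \<Rightarrow> 'i \<Rightarrow> 'j \<Rightarrow> real) \<Rightarrow> ('t \<Rightarrow> real) set"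
  for U G where
  const: "c \<ge> 0 \<Longrightarrow> (\<lambda>_. c) \<in> posy U G"
| entry: "(\<lambda>t. G t i j) \<in> posy U G"
| add: "f \<in> posy U G \<Longrightarrow> g \<in> posy U G \<Longrightarrow> (\<lambda>t. f t + g t) \<in> posy U G"
| mult: "f \<in> posy U G \<Longrightarrow> g \<in> posy U G \<Longrightarrow> (\<lambda>t. f t * g t) \<in> posy U G"
| cong: "f \<in> posy U G \<Longrightarrow> (\<And>t. t \<in> U \<Longrightarrow> g t = f t) \<Longrightarrow> g \<in> posy U G"

lemma posy_nonneg:
  assumes "f \<in> posy U G" "t \<in> U" "\<And>i j. G t i j \<ge> 0"
  shows "f t \<ge> 0"
  using assms(1) by induction (use assms(2,3) in auto)

text \<open>The derivative of a generator is a product of two generators, and the sum and product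
  rules introduce no minus sign.\<close>

lemma posy_has_partial:
  fixes U :: "(real ^ 'd) set" and G :: "real ^ 'd \<Rightarrow> 'd \<Rightarrow> 'd \<Rightarrow> real"
  assumes "f \<in> posy U G" "open U"
    and G: "\<And>t i j k. t \<in> U \<Longrightarrow> has_partial (\<lambda>u. G u i j) (G t i k * G t k j) t k"
  shows "\<exists>f'\<in>posy U G. \<forall>t\<in>U. has_partial f (f' t) t k"
  using assms(1)
proof induction
  case (const c)
  then show ?case using posy.const[of 0 U G] by (intro bexI[where x = "\<lambda>_. 0"]) (simp_all add: has_partial_const)
next
  case (entry i j)
  have "(\<lambda>t. G t i k * G t k j) \<in> posy U G" by (intro posy.mult posy.entry)
  then show ?case using G by (intro bexI[where x = "\<lambda>t. G t i k * G t k j"]) auto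
next
  case (add f g)
  then obtain f' g' where "f' \<in> posy U G" "\<forall>t\<in>U. has_partial f (f' t) t k"
    "g' \<in> posy U G" "\<forall>t\<in>U. has_partial g (g' t) t k" by auto
  then show ?case by (intro bexI[where x = "\<lambda>t. f' t + g' t"]) (auto intro: has_partial_add posy.add)
next
  case (mult f g)
  then obtain f' g' where "f' \<in> posy U G" "\<forall>t\<in>U. has_partial f (f' t) t k"
    "g' \<in> posy U G" "\<forall>t\<in>U. has_partial g (g' t) t k" by auto
  with mult.hyps show ?case
    by (intro bexI[where x = "\<lambda>t. f' t * g t + f t * g' t"])
       (auto intro!: has_partial_mult posy.add posy.mult)
next
  case (cong f g)
  then obtain f' where "f' \<in> posy U G" "\<forall>t\<in>U. has_partial f (f' t) t k" by auto
  with cong.hyps show ?case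
    by (intro bexI[where x = f']) (auto simp: has_partial_cong[OF \<open>open U\<close>, of _ g f])
qed

text \<open>Cone membership is proved on all of \<open>U\<close>, because the induction
  differentiates; signs of the entries of \<open>G\<close> matter only at the single point
  \<open>t\<close>. The conclusion is the inequality for the quotients \<open>m\<close> with
  denominators cleared.\<close>

lemma iterated_partials_supermultiplicative:
  fixes U :: "(real ^ 'd) set" and G :: "real ^ 'd \<Rightarrow> 'd \<Rightarrow> 'd \<Rightarrow> real"
    and F :: "'d list \<Rightarrow> real ^ 'd \<Rightarrow> real"
  assumes U: "open U" and "\<alpha> \<ge> 0"
    and G: "\<And>t i j k. t \<in> U \<Longrightarrow> has_partial (\<lambda>u. G u i j) (G t i k * G t k j) t k"
    and pos: "\<And>t. t \<in> U \<Longrightarrow> F [] t > 0"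
    and Nil: "\<And>t k. t \<in> U \<Longrightarrow> has_partial (F []) (\<alpha> * G t k k * F [] t) t k"
    and Cons: "\<And>t k l. t \<in> U \<Longrightarrow> has_partial (F l) (F (k # l) t) t k"
    and t: "t \<in> U" "\<And>i j. G t i j \<ge> 0"
  shows "F (l @ l') t * F [] t \<ge> F l t * F l' t"
proof -
  define m where "m = (\<lambda>l t. F l t / F [] t)"
  \<comment> \<open>The quotient rule; read backwards, it is the recursion for
    \<open>m (k # l)\<close>.\<close>
  have m_partial: "has_partial (m l) (m (k # l) t - \<alpha> * G t k k * m l t) t k" if "t \<in> U" for t k l
  proof -
    have "(F (k # l) t * F [] t - F l t * (\<alpha> * G t k k * F [] t)) / (F [] t * F [] t)
        = m (k # l) t - \<alpha> * G t k k * m l t"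
      using pos[OF that] by (simp add: m_def field_simps)
    with has_partial_divide[OF Cons[OF that, of l k] Nil[OF that, of k]] pos[OF that]
    show ?thesis by (simp add: m_def)
  qed
  have \<alpha>G: "(\<lambda>t. \<alpha> * G t k k) \<in> posy U G" for k
    using \<open>\<alpha> \<ge> 0\<close> by (intro posy.mult posy.const posy.entry)
  have m_posy: "m l \<in> posy U G" for l
  proof (induction l)
    case Nil
    have "m [] t = 1" if "t \<in> U" for t using pos[OF that] by (simp add: m_def)
    then show ?case by (intro posy.cong[OF posy.const[of 1]]) auto
  next
    case (Cons k l)
    obtain g where g: "g \<in> posy U G" "\<forall>t\<in>U. has_partial (m l) (g t) t k"
      using posy_has_partial[OF Cons U G] by blast
    have "m (k # l) t = g t + \<alpha> * G t k k * m l t" if "t \<in> U" for t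
      using has_partial_unique[OF m_partial[OF that, of l k]] g(2) that by fastforce
    moreover have "(\<lambda>t. g t + \<alpha> * G t k k * m l t) \<in> posy U G"
      by (intro posy.add posy.mult[OF \<alpha>G] g(1) Cons)
    ultimately show ?case by (rule posy.cong[rotated])
  qed
  have "(\<lambda>t. m (l @ l') t - m l t * m l' t) \<in> posy U G"
  proof (induction l)
    case Nil
    have "m [] t = 1" if "t \<in> U" for t using pos[OF that] by (simp add: m_def)
    then show ?case by (intro posy.cong[OF posy.const[of 0]]) auto
  next
    case (Cons k l)
    define r where "r = (\<lambda>t. m (l @ l') t - m l t * m l' t)"
    have r: "r \<in> posy U G" using Cons by (simp add: r_def)
    obtain r' where r': "r' \<in> posy U G" "\<forall>t\<in>U. has_partial r (r' t) t k"
      using posy_has_partial[OF r U G] by blast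
    obtain g where g: "g \<in> posy U G" "\<forall>t\<in>U. has_partial (m l') (g t) t k"
      using posy_has_partial[OF m_posy U G] by blast
    \<comment> \<open>Write \<open>m (l @ l')\<close> as \<open>r + m l * m l'\<close>,
      differentiate, and apply the recursion to \<open>l @ l'\<close> and to \<open>l\<close>. The
      terms \<open>m (k # l) * m l'\<close> and those with
      \<open>\<alpha> * G t k k * m l * m l'\<close> cancel, leaving only summands in the
      cone.\<close>
    have "m ((k # l) @ l') t - m (k # l) t * m l' t = m l t * g t + r' t + \<alpha> * G t k k * r t"
      if t: "t \<in> U" for t
    proof -
      have "m (l @ l') = (\<lambda>u. r u + m l u * m l' u)" by (simp add: r_def fun_eq_iff)
      then have "has_partial (m (l @ l'))
          (r' t + ((m (k # l) t - \<alpha> * G t k k * m l t) * m l' t + m l t * g t)) t k"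
        using r'(2) g(2) t by (auto intro!: has_partial_add has_partial_mult m_partial)
      from has_partial_unique[OF this m_partial[OF t, of "l @ l'" k]]
      show ?thesis by (simp add: r_def algebra_simps)
    qed
    moreover have "(\<lambda>t. m l t * g t + r' t + \<alpha> * G t k k * r t) \<in> posy U G"
      by (intro posy.add posy.mult[OF \<alpha>G] posy.mult m_posy g(1) r r'(1))
    ultimately show ?case by (rule posy.cong[rotated])
  qed
  from posy_nonneg[OF this t] have "m l t * m l' t \<le> m (l @ l') t" by simp
  then show ?thesis using pos[OF t(1)] by (simp add: m_def field_simps)
qed

section \<open>Exponentially tilted moments as iterated partial derivatives\<close>

lemma has_partial_moments:
  fixes X :: "'a \<Rightarrow> real ^ 'd"
  assumes X [measurable]: "X \<in> borel_measurable M" and "open U"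
    and int: "\<And>t. t \<in> U \<Longrightarrow> integrable M (\<lambda>\<omega>. exp (t \<bullet> X \<omega>))"
    and "t \<in> U"
  defines "W \<equiv> \<lambda>l t \<omega>. (\<Prod>j\<leftarrow>l. X \<omega> $ j) * exp (t \<bullet> X \<omega>)"
  shows "has_partial (\<lambda>t. \<integral>\<omega>. W l t \<omega> \<partial>M) (\<integral>\<omega>. W (k # l) t \<omega> \<partial>M) t k"
proof -
  \<comment> \<open>Integrability is carried along with the derivative: differentiating once more
    needs it for \<open>k # l\<close> at every point of \<open>U\<close>.\<close>
  have step: "integrable M (W (k # l) t) \<and>
      has_partial (\<lambda>t. \<integral>\<omega>. W l t \<omega> \<partial>M) (\<integral>\<omega>. W (k # l) t \<omega> \<partial>M) t k"
    if l: "\<And>t. t \<in> U \<Longrightarrow> integrable M (W l t)" and t: "t \<in> U" for l t k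
  proof -
    obtain e where e: "e > 0" "cball t e \<subseteq> U"
      using \<open>open U\<close> t open_contains_cball by blast
    \<comment> \<open>Moving \<open>t\<close> along axis \<open>k\<close> multiplies the integrand
      by an exponential in \<open>X \<omega> $ k\<close>, which is the shape of the one-variable
      lemma with weight \<open>W l t\<close>.\<close>
    have shift: "W l (t + s *\<^sub>R axis k 1) = (\<lambda>\<omega>. W l t \<omega> * exp (s * X \<omega> $ k))" for s
      by (simp add: W_def fun_eq_iff inner_add_left exp_add inner_axis' mult.assoc)
    have "t + s *\<^sub>R axis k 1 \<in> U" if "\<bar>s\<bar> \<le> e" for s
      using e(2) that by (intro subsetD[OF e(2)]) (simp add: dist_norm)
    then have *: "integrable M (\<lambda>\<omega>. W l t \<omega> * exp (s * X \<omega> $ k))" if "\<bar>s\<bar> \<le> e" for s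
      using l that by (simp flip: shift)
    have Y: "(\<lambda>\<omega>. X \<omega> $ k) \<in> borel_measurable M"
      using X by (simp add: cart_eq_inner_axis)
    have W: "W (k # l) t = (\<lambda>\<omega>. X \<omega> $ k * W l t \<omega>)" by (simp add: W_def fun_eq_iff)
    show ?thesis
      using has_real_derivative_integral_exp[OF Y e(1) *]
      unfolding has_partial_def shift W by simp
  qed
  have "integrable M (W l t)" if "t \<in> U" for t l
    using that
  proof (induction l arbitrary: t)
    case Nil
    then show ?case using int by (simp add: W_def)
  qed (use step in blast)
  then show ?thesis using step \<open>t \<in> U\<close> by blast
qed

section \<open>The matrix G of the overview and its partial derivatives\<close>

definition resolvent :: "real ^ 'd ^ 'd \<Rightarrow> real ^ 'd \<Rightarrow> 'd \<Rightarrow> 'd \<Rightarrow> real" where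
  "resolvent \<Sigma> t i j = (matrix_inv (mat 1 - \<Sigma> ** diag_matrix t) ** \<Sigma>) $ i $ j"

lemma matrix_mult_diag_matrix: "(A ** diag_matrix v) $ i $ j = A $ i $ j * v $ j"
  unfolding matrix_matrix_mult_def diag_matrix_def
  by (simp add: if_distrib[of "\<lambda>x. _ * x"] cong: if_cong)

lemma diag_matrix_mult: "(diag_matrix v ** A) $ i $ j = v $ i * A $ i $ j"
  unfolding matrix_matrix_mult_def diag_matrix_def
  by (simp add: if_distrib[of "\<lambda>x. x * _"] cong: if_cong)

lemma matrix_inv_left_right:
  fixes A :: "real ^ 'd ^ 'd"
  assumes "det A \<noteq> 0"
  shows "matrix_inv A ** A = mat 1" "A ** matrix_inv A = mat 1"
proof -
  have "\<exists>A'. A ** A' = mat 1 \<and> A' ** A = mat 1"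
    using assms invertible_det_nz[of A] by (simp add: invertible_def)
  from someI_ex[OF this] show "matrix_inv A ** A = mat 1" "A ** matrix_inv A = mat 1"
    by (auto simp: matrix_inv_def)
qed

text \<open>Multiplying by the inverse on the left cancels it, so a candidate is verified without
  computing any inverse. The determinant hypothesis excludes singular matrices, on which
  \<open>matrix_inv\<close> is unspecified.\<close>

lemma resolvent_eqI:
  fixes H :: "real ^ 'd ^ 'd"
  assumes "det (mat 1 - \<Sigma> ** diag_matrix t) \<noteq> 0" "(mat 1 - \<Sigma> ** diag_matrix t) ** H = \<Sigma>"
  shows "resolvent \<Sigma> t i j = H $ i $ j"
proof -
  have "matrix_inv (mat 1 - \<Sigma> ** diag_matrix t) ** ((mat 1 - \<Sigma> ** diag_matrix t) ** H) = H"
    using matrix_inv_left_right[OF assms(1)] by (simp add: matrix_mul_assoc)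
  then show ?thesis by (simp add: resolvent_def assms(2))
qed

lemma resolvent_left_inverse:
  assumes "det (mat 1 - \<Sigma> ** diag_matrix t) \<noteq> 0"
  shows "(mat 1 - \<Sigma> ** diag_matrix t) ** (\<chi> i j. resolvent \<Sigma> t i j) = \<Sigma>"
proof -
  have "(\<chi> i j. resolvent \<Sigma> t i j) = matrix_inv (mat 1 - \<Sigma> ** diag_matrix t) ** \<Sigma>"
    by (simp add: resolvent_def vec_eq_iff)
  then show ?thesis using matrix_inv_left_right[OF assms] by (simp add: matrix_mul_assoc)
qed

text \<open>The shift changes only column \<open>k\<close>, so Cramer's rule gives the new determinant.\<close>

lemma det_shift:
  fixes \<Sigma> :: "real ^ 'd ^ 'd"
  assumes "det (mat 1 - \<Sigma> ** diag_matrix t) \<noteq> 0"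
  shows "det (mat 1 - \<Sigma> ** diag_matrix (t + s *\<^sub>R axis k 1)) =
    (1 - s * resolvent \<Sigma> t k k) * det (mat 1 - \<Sigma> ** diag_matrix t)"
proof -
  define B where "B = mat 1 - \<Sigma> ** diag_matrix t"
  \<comment> \<open>Chosen so that \<open>B *v x\<close> is column \<open>k\<close> of the shifted
    matrix: \<open>B\<close> sends the axis vector to its own column \<open>k\<close> and the
    resolvent column to column \<open>k\<close> of \<Sigma>.\<close>
  define x where "x = axis k 1 - s *\<^sub>R (\<chi> i. resolvent \<Sigma> t i k)"
  have "B *v (\<chi> i. resolvent \<Sigma> t i k) = column k \<Sigma>"
    using arg_cong[OF resolvent_left_inverse[OF assms], of "column k"]
    by (simp add: B_def vec_eq_iff column_def matrix_matrix_mult_def matrix_vector_mult_def)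
  then have Bx: "B *v x = column k B - s *\<^sub>R column k \<Sigma>"
    by (simp add: x_def matrix_vector_mult_diff_distrib matrix_vector_mult_scaleR
        matrix_vector_mult_basis)
  have "mat 1 - \<Sigma> ** diag_matrix (t + s *\<^sub>R axis k 1) =
      (\<chi> i j. if j = k then (B *v x) $ i else B $ i $ j)"
    unfolding Bx by (simp add: vec_eq_iff B_def column_def matrix_mult_diag_matrix axis_def algebra_simps)
  then have "det (mat 1 - \<Sigma> ** diag_matrix (t + s *\<^sub>R axis k 1)) = x $ k * det B"
    by (simp add: cramer_lemma)
  then show ?thesis by (simp add: x_def B_def)
qed

text \<open>The Sherman--Morrison formula for a rank one perturbation.\<close>

lemma resolvent_shift:
  fixes \<Sigma> :: "real ^ 'd ^ 'd"
  assumes det: "det (mat 1 - \<Sigma> ** diag_matrix t) \<noteq> 0" and nz: "1 - s * resolvent \<Sigma> t k k \<noteq> 0"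
  shows "resolvent \<Sigma> (t + s *\<^sub>R axis k 1) i j = resolvent \<Sigma> t i j +
    s * (resolvent \<Sigma> t i k * resolvent \<Sigma> t k j) / (1 - s * resolvent \<Sigma> t k k)"
proof -
  define G where "G = resolvent \<Sigma> t"
  define B where "B = mat 1 - \<Sigma> ** diag_matrix t"
  define B' where "B' = mat 1 - \<Sigma> ** diag_matrix (t + s *\<^sub>R axis k 1)"
  \<comment> \<open>The claimed formula as a matrix; by \<open>resolvent_eqI\<close> it remains to
    check \<open>B' ** H = \<Sigma>\<close>.\<close>
  define H :: "real ^ 'd ^ 'd" where "H = (\<chi> i j. G i j + s * (G i k * G k j) / (1 - s * G k k))"
  have BG: "(\<Sum>l\<in>UNIV. B $ i $ l * G l j) = \<Sigma> $ i $ j" for i j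
    using resolvent_left_inverse[OF det]
    by (simp add: B_def G_def vec_eq_iff matrix_matrix_mult_def)
  have "B' $ i $ l = B $ i $ l - (if l = k then s * \<Sigma> $ i $ k else 0)" for i l
    by (simp add: B_def B'_def matrix_mult_diag_matrix axis_def algebra_simps)
  then have B'_sum: "(\<Sum>l\<in>UNIV. B' $ i $ l * v l) = (\<Sum>l\<in>UNIV. B $ i $ l * v l) - s * \<Sigma> $ i $ k * v k" for i v
    by (simp add: left_diff_distrib sum_subtractf if_distrib[of "\<lambda>x. x * _"] cong: if_cong)
  have "(B' ** H) $ i $ j = \<Sigma> $ i $ j" for i j
  proof -
    have "(\<Sum>l\<in>UNIV. B $ i $ l * H $ l $ j) =
        (\<Sum>l\<in>UNIV. B $ i $ l * G l j + B $ i $ l * G l k * (s * G k j / (1 - s * G k k)))"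
      by (intro sum.cong) (simp_all add: H_def distrib_left mult.assoc mult.left_commute[of s])
    also have "\<dots> = \<Sigma> $ i $ j + \<Sigma> $ i $ k * (s * G k j / (1 - s * G k k))"
      unfolding sum.distrib sum_distrib_right[symmetric] BG ..
    finally have "(B' ** H) $ i $ j = \<Sigma> $ i $ j + \<Sigma> $ i $ k * (s * G k j / (1 - s * G k k))
        - s * \<Sigma> $ i $ k * (G k j + s * (G k k * G k j) / (1 - s * G k k))"
      unfolding matrix_matrix_mult_def by (simp add: B'_sum) (simp add: H_def)
    \<comment> \<open>Over the common denominator the two terms in
      \<open>s * (G k k * G k j)\<close> cancel.\<close>
    also have "G k j + s * (G k k * G k j) / (1 - s * G k k) = G k j / (1 - s * G k k)"
      using nz by (simp add: G_def field_simps)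
    also have "\<Sigma> $ i $ j + \<Sigma> $ i $ k * (s * G k j / (1 - s * G k k)) - s * \<Sigma> $ i $ k * (G k j / (1 - s * G k k)) = \<Sigma> $ i $ j"
      by simp
    finally show ?thesis .
  qed
  then have "B' ** H = \<Sigma>" by (simp add: vec_eq_iff)
  moreover have "det B' \<noteq> 0" using det_shift[OF det, of s k] det nz by (simp add: B'_def)
  ultimately show ?thesis using resolvent_eqI[of \<Sigma> "t + s *\<^sub>R axis k 1" H] by (simp add: B'_def H_def G_def)
qed

text \<open>Keeps the Sherman--Morrison denominator nonzero and the base of \<open>powr\<close>
  positive for small shifts.\<close>

lemma eventually_one_minus_mult_pos: "\<forall>\<^sub>F s in nhds (0::real). 1 - s * g > 0"
proof -
  have "((\<lambda>s. 1 - s * g) \<longlongrightarrow> 1) (nhds 0)"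
    by (auto intro!: tendsto_eq_intros filterlim_ident)
  then show ?thesis by (rule order_tendstoD) simp
qed

text \<open>Near \<open>s = 0\<close> the Sherman--Morrison formula is an explicit rational function
  of \<open>s\<close>, whose derivative at 0 is the coefficient of \<open>s\<close> in its
  numerator.\<close>

lemma has_partial_resolvent:
  assumes "det (mat 1 - \<Sigma> ** diag_matrix t) \<noteq> 0"
  shows "has_partial (\<lambda>u. resolvent \<Sigma> u i j) (resolvent \<Sigma> t i k * resolvent \<Sigma> t k j) t k"
proof -
  define g where "g = resolvent \<Sigma> t i k * resolvent \<Sigma> t k j"
  have "((\<lambda>s. resolvent \<Sigma> t i j + s * g / (1 - s * resolvent \<Sigma> t k k)) has_real_derivative g) (at 0)"
    by (auto intro!: derivative_eq_intros)
  moreover have "\<forall>\<^sub>F s in nhds 0. resolvent \<Sigma> (t + s *\<^sub>R axis k 1) i j =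
      resolvent \<Sigma> t i j + s * g / (1 - s * resolvent \<Sigma> t k k)"
    using eventually_one_minus_mult_pos[of "resolvent \<Sigma> t k k"]
    by eventually_elim (use resolvent_shift[OF assms] in \<open>simp add: g_def\<close>)
  ultimately show ?thesis unfolding has_partial_def g_def
    by (subst DERIV_cong_ev[OF refl _ refl]) auto
qed

text \<open>By \<open>det_shift\<close> the determinant is affine in \<open>s\<close>; both of its
  factors are positive for small \<open>s\<close>, so \<open>powr\<close> splits over the
  product.\<close>

lemma has_partial_det_powr:
  fixes \<Sigma> :: "real ^ 'd ^ 'd"
  assumes "det (mat 1 - \<Sigma> ** diag_matrix t) > 0"
  shows "has_partial (\<lambda>u. det (mat 1 - \<Sigma> ** diag_matrix u) powr (- \<alpha>))
    (\<alpha> * resolvent \<Sigma> t k k * det (mat 1 - \<Sigma> ** diag_matrix t) powr (- \<alpha>)) t k"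
proof -
  define g where "g = resolvent \<Sigma> t k k"
  define D where "D = det (mat 1 - \<Sigma> ** diag_matrix t)"
  have D: "D > 0" using assms by (simp add: D_def)
  have "((\<lambda>s. (1 - s * g) powr (- \<alpha>) * D powr (- \<alpha>)) has_real_derivative \<alpha> * g * D powr (- \<alpha>)) (at 0)"
    by (auto intro!: derivative_eq_intros)
  moreover have "\<forall>\<^sub>F s in nhds 0. det (mat 1 - \<Sigma> ** diag_matrix (t + s *\<^sub>R axis k 1)) powr (- \<alpha>) =
      (1 - s * g) powr (- \<alpha>) * D powr (- \<alpha>)"
    using eventually_one_minus_mult_pos[of g]
    by eventually_elim (use det_shift[of \<Sigma> t] D in \<open>simp add: g_def D_def powr_mult\<close>)
  ultimately show ?thesis unfolding has_partial_def g_def D_def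
    by (subst DERIV_cong_ev[OF refl _ refl]) auto
qed

lemma one_minus_mult_diag_0: "mat 1 - \<Sigma> ** diag_matrix 0 = mat 1"
  by (simp add: vec_eq_iff matrix_mult_diag_matrix)

lemma resolvent_0: "resolvent \<Sigma> 0 i j = \<Sigma> $ i $ j"
  by (rule resolvent_eqI) (simp_all add: one_minus_mult_diag_0)

lemma eventually_det_pos:
  fixes \<Sigma> :: "real ^ 'd ^ 'd"
  shows "\<forall>\<^sub>F t in nhds 0. det (mat 1 - \<Sigma> ** diag_matrix t) > 0"
proof -
  have "((\<lambda>t. t $ i) \<longlongrightarrow> (0 :: real ^ 'd) $ i) (nhds 0)" for i
    by (intro tendsto_vec_nth filterlim_ident)
  then have "((\<lambda>t. det (mat 1 - \<Sigma> ** diag_matrix t)) \<longlongrightarrow> det (mat 1 - \<Sigma> ** diag_matrix 0)) (nhds 0)"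
    \<comment> \<open>The Leibniz expansion shows that the determinant is a polynomial in the
      coordinates of \<open>t\<close>, hence continuous.\<close>
    unfolding det_def vector_minus_component matrix_mult_diag_matrix
    by (intro tendsto_sum tendsto_prod tendsto_mult tendsto_diff tendsto_const)
  then show ?thesis by (intro order_tendstoD(1)[of _ 1]) (auto simp: one_minus_mult_diag_0)
qed

section \<open>Gamma moments, the sign change and the conclusion\<close>

lemma gamma_moments_supermultiplicative:
  fixes X :: "'a \<Rightarrow> real ^ 'd"
  assumes "\<alpha> > 0" and X: "gamma_distributed M \<alpha> \<Sigma> X" and \<Sigma>: "\<And>i j. \<Sigma> $ i $ j \<ge> 0"
  shows "(\<integral>\<omega>. (\<Prod>j\<leftarrow>l. X \<omega> $ j) \<partial>M) * (\<integral>\<omega>. (\<Prod>j\<leftarrow>l'. X \<omega> $ j) \<partial>M) \<le>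
    (\<integral>\<omega>. (\<Prod>j\<leftarrow>l @ l'. X \<omega> $ j) \<partial>M)"
proof -
  define \<phi> where "\<phi> = (\<lambda>t. det (mat 1 - \<Sigma> ** diag_matrix t) powr (- \<alpha>))"
  have meas: "X \<in> borel_measurable M"
    and ev: "\<forall>\<^sub>F t in nhds 0. has_bochner_integral M (\<lambda>\<omega>. exp (t \<bullet> X \<omega>)) (\<phi> t)"
    using X by (simp_all add: gamma_distributed_def \<phi>_def inner_vec_def)
  obtain U where U: "open U" "0 \<in> U"
    and int: "\<And>t. t \<in> U \<Longrightarrow> has_bochner_integral M (\<lambda>\<omega>. exp (t \<bullet> X \<omega>)) (\<phi> t)"
    and det: "\<And>t. t \<in> U \<Longrightarrow> det (mat 1 - \<Sigma> ** diag_matrix t) > 0"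
    using eventually_conj[OF ev eventually_det_pos[of \<Sigma>]] unfolding eventually_nhds by blast
  define F where "F = (\<lambda>l t. \<integral>\<omega>. (\<Prod>j\<leftarrow>l. X \<omega> $ j) * exp (t \<bullet> X \<omega>) \<partial>M)"
  have F_Nil: "F [] t = \<phi> t" if "t \<in> U" for t
    using int[OF that] by (simp add: F_def has_bochner_integral_integral_eq)
  have "F l 0 * F l' 0 \<le> F (l @ l') 0 * F [] 0"
  proof (rule iterated_partials_supermultiplicative[OF U(1)])
    fix t k assume t: "t \<in> U"
    show "has_partial (\<lambda>u. resolvent \<Sigma> u i j) (resolvent \<Sigma> t i k * resolvent \<Sigma> t k j) t k" for i j
      using det[OF t] by (intro has_partial_resolvent) auto
    show "F [] t > 0" using F_Nil[OF t] det[OF t] by (simp add: \<phi>_def)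
    have "has_partial \<phi> (\<alpha> * resolvent \<Sigma> t k k * \<phi> t) t k"
      unfolding \<phi>_def by (rule has_partial_det_powr[OF det[OF t]])
    then show "has_partial (F []) (\<alpha> * resolvent \<Sigma> t k k * F [] t) t k"
      using has_partial_cong[OF U(1) t F_Nil] F_Nil[OF t] by simp
    show "has_partial (F l) (F (k # l) t) t k" for l
      unfolding F_def using has_partial_moments[OF meas U(1) _ t] int has_bochner_integral_iff by blast
  qed (use U \<Sigma> \<open>\<alpha> > 0\<close> in \<open>auto simp: resolvent_0\<close>)
  \<comment> \<open>The total mass is the value of the moment generating function at 0, where the
    determinant is 1.\<close>
  moreover have "F [] 0 = 1"
    using F_Nil[OF U(2)] by (simp add: \<phi>_def one_minus_mult_diag_0)
  ultimately show ?thesis by (simp add: F_def)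
qed

text \<open>Diagonal matrices commute and \<open>S ** S\<close> is the identity, so the new matrix
  in the determinant is the old one conjugated by \<open>S\<close>. The vector \<open>X\<close>
  itself is unchanged.\<close>

lemma gamma_distributed_sign_conj:
  fixes \<Sigma> :: "real ^ 'd ^ 'd"
  assumes "sign_matrix S" "gamma_distributed M \<alpha> \<Sigma> X"
  shows "gamma_distributed M \<alpha> (S ** \<Sigma> ** S) X"
proof -
  obtain s where s: "\<And>j. s $ j \<in> {-1, 1}" and S: "S = diag_matrix s"
    using assms(1) by (auto simp: sign_matrix_def)
  have ss: "s $ i * s $ i = 1" for i using s[of i] by auto
  have SS: "S ** S = mat 1"
    by (simp add: S vec_eq_iff matrix_mult_diag_matrix) (simp add: diag_matrix_def mat_def ss)
  have "det (mat 1 - S ** \<Sigma> ** S ** diag_matrix t) = det (mat 1 - \<Sigma> ** diag_matrix t)" for t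
  proof -
    have "mat 1 - S ** \<Sigma> ** S ** diag_matrix t = S ** (mat 1 - \<Sigma> ** diag_matrix t) ** S"
      by (auto simp: S vec_eq_iff matrix_mult_diag_matrix diag_matrix_mult mat_def ss algebra_simps)
    moreover have "det S * det S = 1" using arg_cong[OF SS, of det] by (simp add: det_mul)
    ultimately show ?thesis by (simp add: det_mul)
  qed
  then show ?thesis using assms(2) by (simp add: gamma_distributed_def)
qed

text \<open>The list repeats each index \<open>j\<close> exactly \<open>n j\<close> times. One list
  serves every \<open>x\<close>, as is needed under the integral sign.\<close>

lemma prod_power_eq_prod_list:
  assumes "finite A"
  shows "\<exists>l. \<forall>x :: 'b \<Rightarrow> 'a::comm_monoid_mult. (\<Prod>j\<in>A. x j ^ n j) = (\<Prod>j\<leftarrow>l. x j)"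
  using assms
proof induction
  case (insert a A)
  then obtain l where "\<forall>x :: 'b \<Rightarrow> 'a. (\<Prod>j\<in>A. x j ^ n j) = (\<Prod>j\<leftarrow>l. x j)" by blast
  with insert.hyps have "\<forall>x :: 'b \<Rightarrow> 'a. (\<Prod>j\<in>insert a A. x j ^ n j) = (\<Prod>j\<leftarrow>replicate (n a) a @ l. x j)"
    by simp
  then show ?case by blast
qed (auto intro: exI[of _ "[]"])

theorem theorem2p1:
  fixes M :: "'a measure"
    and \<alpha> :: real
    and \<Sigma> :: "real ^ 'd ^ 'd"
    and X :: "'a \<Rightarrow> real ^ 'd"
    and I :: "'d set"
    and n :: "'d \<Rightarrow> nat"
  assumes "prob_space M"
    and "\<alpha> > 0"
    and "pos_semidef \<Sigma>"
    and "gamma_distributed M \<alpha> \<Sigma> X"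
    and "\<exists>S. sign_matrix S \<and> (\<forall>i j. (S ** \<Sigma> ** S) $ i $ j \<ge> 0)"
  shows "(\<integral>\<omega>. (\<Prod>j\<in>UNIV. (X \<omega> $ j) ^ n j) \<partial>M) \<ge>
    (\<integral>\<omega>. (\<Prod>j\<in>I. (X \<omega> $ j) ^ n j) \<partial>M) * (\<integral>\<omega>. (\<Prod>j\<in>- I. (X \<omega> $ j) ^ n j) \<partial>M)"
proof -
  obtain S where S: "sign_matrix S" "\<And>i j. (S ** \<Sigma> ** S) $ i $ j \<ge> 0" using assms(5) by blast
  obtain l where l: "\<forall>x :: 'd \<Rightarrow> real. (\<Prod>j\<in>I. x j ^ n j) = (\<Prod>j\<leftarrow>l. x j)"
    using prod_power_eq_prod_list[of I n] by auto
  obtain l' where l': "\<forall>x :: 'd \<Rightarrow> real. (\<Prod>j\<in>- I. x j ^ n j) = (\<Prod>j\<leftarrow>l'. x j)"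
    using prod_power_eq_prod_list[of "- I" n] by auto
  \<comment> \<open>The full product splits over \<open>I\<close> and its complement, so it is
    encoded by concatenating the two lists.\<close>
  have "(\<Prod>j\<in>UNIV. x j ^ n j) = (\<Prod>j\<leftarrow>l @ l'. x j)" for x :: "'d \<Rightarrow> real"
    using l l' prod.union_disjoint[of I "- I" "\<lambda>j. x j ^ n j"] by simp
  then show ?thesis
    using gamma_moments_supermultiplicative[OF assms(2)
        gamma_distributed_sign_conj[OF S(1) assms(4)] S(2), of l l'] l l' by simp
qed

end
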